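(* Let $\tau>0$, let $\boldsymbol{A}=\boldsymbol{A}^{\mathrm{CN}}\in\mathbb{C}^{n\times n}$ be the Hermitian matrix learned by the Crank--Nicolson DMD (CN-DMD) from snapshot data with time step $\tau$ (see context), and let $\{\boldsymbol{x}_k\}_{k\ge 0}\subset\mathbb{C}^n$ be the CN-DMD iterates with initial state $\boldsymbol{x}_0\in\mathbb{C}^n$, i.e. $$\boldsymbol{x}_{k+1}=\Bigl(\boldsymbol{I}+\imath\tfrac{\tau}{2}\boldsymbol{A}\Bigr)^{-1}\Bigl(\boldsymbol{I}-\imath\tfrac{\tau}{2}\boldsymbol{A}\Bigr)\boldsymbol{x}_k,\qquad k\ge 0.$$ Then CN-DMD preserves both the discretized mass and the discretized energy: $$\|\boldsymbol{x}_k\|_2=\|\boldsymbol{x}_0\|_2\quad\text{for any }k\in\mathbb{N},$$ and, with the discretized quadratic energy functional $E(\boldsymbol{x}):=\boldsymbol{x}^*\boldsymbol{A}\boldsymbol{x}$, $$E(\boldsymbol{x}_k)=E(\boldsymbol{x}_0)\quad\text{for any }k\in\mathbb{N}.$$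
   Context: Here $\imath$ is the imaginary unit, $\boldsymbol{I}$ the $n\times n$ identity, $^*$ the conjugate transpose, $\|\cdot\|_2$ the Euclidean norm, $\|\cdot\|_{\mathrm F}$ the Frobenius norm. CN-DMD: given snapshots $\boldsymbol{y}_0,\dots,\boldsymbol{y}_m\in\mathbb{C}^n$ ($m\le n$) with time step $\tau>0$ between consecutive snapshots, form the $n\times m$ data matrices $$\boldsymbol{X}_1=\Bigl[\tfrac{\boldsymbol{y}_0+\boldsymbol{y}_1}{2},\dots,\tfrac{\boldsymbol{y}_{m-1}+\boldsymbol{y}_m}{2}\Bigr],\qquad \boldsymbol{X}_2=\Bigl[\imath\tfrac{\boldsymbol{y}_1-\boldsymbol{y}_0}{\tau},\dots,\imath\tfrac{\boldsymbol{y}_m-\boldsymbol{y}_{m-1}}{\tau}\Bigr].$$ The matrix $\boldsymbol{A}^{\mathrm{CN}}$ is the minimal-Frobenius-norm solution of the Hermitian Procrustes problem $\min_{\boldsymbol{A}=\boldsymbol{A}^*}\|\boldsymbol{X}_2-\boldsymbol{A}\boldsymbol{X}_1\|_{\mathrm F}$ over $\boldsymbol{A}\in\mathbb{C}^{n\times n}$. In particular $\boldsymbol{A}^{\mathrm{CN}}$ is Hermitian. *)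

theory Defs
  imports "HOL-Analysis.Analysis"
begin

text \<open>
  On \<open>complex ^ 'n\<close> the library norm is the Euclidean norm, and on
  \<open>complex ^ 'm ^ 'n\<close> (\<open>n\<close> rows, \<open>m\<close> columns) it is the Frobenius norm.
\<close>

definition ctranspose :: "complex ^ 'm ^ 'n \<Rightarrow> complex ^ 'n ^ 'm" where
  "ctranspose A = map_matrix cnj (transpose A)"

definition hermitian :: "complex ^ 'n ^ 'n \<Rightarrow> bool" where
  "hermitian A \<longleftrightarrow> ctranspose A = A"

definition cscale :: "complex \<Rightarrow> complex ^ 'm ^ 'n \<Rightarrow> complex ^ 'm ^ 'n"  (infixr \<open>*\<^sub>M\<close> 75) where
  "c *\<^sub>M A = map_matrix ((*) c) A"

definition procrustes_solution ::
    "complex ^ 'm ^ 'n \<Rightarrow> complex ^ 'm ^ 'n \<Rightarrow> complex ^ 'n ^ 'n \<Rightarrow> bool" where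
  "procrustes_solution X1 X2 A \<longleftrightarrow>
     hermitian A \<and> (\<forall>B. hermitian B \<longrightarrow> norm (X2 - A ** X1) \<le> norm (X2 - B ** X1))"

definition min_norm_procrustes_solution ::
    "complex ^ 'm ^ 'n \<Rightarrow> complex ^ 'm ^ 'n \<Rightarrow> complex ^ 'n ^ 'n \<Rightarrow> bool" where
  "min_norm_procrustes_solution X1 X2 A \<longleftrightarrow>
     procrustes_solution X1 X2 A \<and> (\<forall>B. procrustes_solution X1 X2 B \<longrightarrow> norm A \<le> norm B)"

definition hermitian_procrustes ::
    "complex ^ 'm ^ 'n \<Rightarrow> complex ^ 'm ^ 'n \<Rightarrow> complex ^ 'n ^ 'n" where
  "hermitian_procrustes X1 X2 = (THE A. min_norm_procrustes_solution X1 X2 A)"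

text \<open>
  The snapshots are \<open>y 0, \<dots>, y m\<close>. The \<open>m\<close> columns of the data matrices are indexed by a
  finite linearly ordered type \<open>'m\<close> with \<open>CARD('m) = m\<close>; \<open>col_pos\<close> enumerates it
  increasingly as \<open>0, \<dots>, m - 1\<close>. Values of \<open>y\<close> beyond \<open>m\<close> play no role.
\<close>

definition col_pos :: "'m::{finite,linorder} \<Rightarrow> nat" where
  "col_pos j = card {..<j}"

definition cn_X1 :: "(nat \<Rightarrow> complex ^ 'n) \<Rightarrow> complex ^ 'm::{finite,linorder} ^ 'n" where
  "cn_X1 y = (\<chi> i j. (y (col_pos j) $ i + y (col_pos j + 1) $ i) / 2)"

definition cn_X2 :: "real \<Rightarrow> (nat \<Rightarrow> complex ^ 'n) \<Rightarrow> complex ^ 'm::{finite,linorder} ^ 'n" where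
  "cn_X2 \<tau> y = (\<chi> i j. \<i> * ((y (col_pos j + 1) $ i - y (col_pos j) $ i) / of_real \<tau>))"

definition energy :: "complex ^ 'n ^ 'n \<Rightarrow> complex ^ 'n \<Rightarrow> complex" where
  "energy A x = (\<Sum>i\<in>UNIV. cnj (x $ i) * (A *v x) $ i)"

lemma bij_betw_col_pos:
  "bij_betw (col_pos :: 'm::{finite,linorder} \<Rightarrow> nat) UNIV {..<CARD('m)}"
proof -
  have "strict_mono (col_pos :: 'm \<Rightarrow> nat)"
    unfolding strict_mono_def col_pos_def by (auto intro!: psubset_card_mono)
  then have inj: "inj (col_pos :: 'm \<Rightarrow> nat)"
    by (rule strict_mono_imp_inj_on)
  have "col_pos j < CARD('m)" for j :: 'm
    unfolding col_pos_def by (rule psubset_card_mono) auto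
  then have "range (col_pos :: 'm \<Rightarrow> nat) = {..<CARD('m)}"
    by (intro card_subset_eq) (auto simp: card_image[OF inj])
  with inj show ?thesis by (simp add: bij_betw_def)
qed

lemma subspace_hermitian: "subspace {A. hermitian A}"
  by (auto simp: subspace_def hermitian_def ctranspose_def transpose_def vec_eq_iff)

text \<open>The minimal-norm solution exists and is unique, so the description above denotes it.\<close>

lemma ex1_min_norm_procrustes_solution:
  fixes X1 X2 :: "complex ^ 'm ^ 'n"
  shows "\<exists>!A. min_norm_procrustes_solution X1 X2 A"
proof -
  define H where "H = {A :: complex ^ 'n ^ 'n. hermitian A}"
  define R where "R = (\<lambda>A :: complex ^ 'n ^ 'n. A ** X1)"
  define p where "p = closest_point (R ` H) X2"
  have lin: "linear R"
    unfolding R_def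
    by (intro linearI) (simp_all add: vec_eq_iff matrix_matrix_mult_def scaleR_sum_right
        ring_distribs sum.distrib)
  have subH: "subspace H" unfolding H_def by (rule subspace_hermitian)
  have subR: "subspace (R ` H)" using lin subH by (rule linear_subspace_image)
  have clR: "closed (R ` H)" "convex (R ` H)" "R ` H \<noteq> {}"
    using subR closed_subspace subspace_imp_convex subspace_0 by blast+
  have pin: "p \<in> R ` H" unfolding p_def using clR by (intro closest_point_in_set)
  have ple: "dist X2 p \<le> dist X2 z" if "z \<in> R ` H" for z
    unfolding p_def using clR that by (intro closest_point_le)
  have sol: "procrustes_solution X1 X2 A \<longleftrightarrow> A \<in> H \<and> R A = p" for A
  proof
    assume A: "procrustes_solution X1 X2 A"
    then have "A \<in> H" by (simp add: procrustes_solution_def H_def)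
    moreover have "\<forall>z\<in>R ` H. dist X2 (R A) \<le> dist X2 z"
      using A by (auto simp: procrustes_solution_def H_def R_def dist_norm)
    ultimately show "A \<in> H \<and> R A = p"
      unfolding p_def using clR by (auto intro!: closest_point_unique)
  next
    assume "A \<in> H \<and> R A = p"
    then show "procrustes_solution X1 X2 A"
      using ple by (auto simp: procrustes_solution_def H_def R_def dist_norm)
  qed
  define S where "S = H \<inter> R -` {p}"
  have clS: "closed S" "convex S" "S \<noteq> {}"
  proof -
    show "closed S"
      unfolding S_def using closed_subspace[OF subH] lin
      by (intro closed_Int closed_vimage) (auto intro: linear_continuous_on linear_conv_bounded_linear[THEN iffD1])
    show "convex S"
      unfolding S_def using subspace_imp_convex[OF subH] lin
      by (intro convex_Int convex_linear_vimage) auto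
    show "S \<noteq> {}" using pin by (auto simp: S_def)
  qed
  have mn: "min_norm_procrustes_solution X1 X2 A \<longleftrightarrow> A \<in> S \<and> (\<forall>B\<in>S. dist 0 A \<le> dist 0 B)" for A
    by (auto simp: min_norm_procrustes_solution_def sol S_def)
  show ?thesis
  proof
    show "min_norm_procrustes_solution X1 X2 (closest_point S 0)"
      unfolding mn using clS closest_point_in_set closest_point_le by blast
    show "A = closest_point S 0" if "min_norm_procrustes_solution X1 X2 A" for A
      using that clS unfolding mn by (auto intro!: closest_point_unique)
  qed
qed

lemma hermitian_procrustes: "min_norm_procrustes_solution X1 X2 (hermitian_procrustes X1 X2)"
  unfolding hermitian_procrustes_def by (rule theI'[OF ex1_min_norm_procrustes_solution])

end

theory Submission
  imports Defs
begin

text \<open>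
  With \<open>v = x\<^sub>k\<close>, \<open>w = x\<^sub>k\<^sub>+\<^sub>1\<close> and \<open>u = w + v\<close>, the scheme reads
  \<open>w - v = -\<i>(\<tau>/2) A u\<close>. For the real inner product \<open>\<bullet>\<close> (the real part of the
  Hermitian one), \<open>w \<bullet> w - v \<bullet> v = u \<bullet> (w - v)\<close> and, since \<open>A\<close> is self-adjoint,
  \<open>w \<bullet> A w - v \<bullet> A v = A u \<bullet> (w - v)\<close>. Both vanish: \<open>u\<^sup>* A u\<close> and
  \<open>(A u)\<^sup>* (A u)\<close> are real, and they get multiplied by an imaginary number.
\<close>

definition cdot :: "complex ^ 'n \<Rightarrow> complex ^ 'n \<Rightarrow> complex" where
  "cdot x y = (\<Sum>i\<in>UNIV. cnj (x $ i) * y $ i)"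

lemma energy_eq_cdot: "energy A x = cdot x (A *v x)"
  by (simp add: energy_def cdot_def)

lemma Re_cdot: "Re (cdot x y) = x \<bullet> y"
  by (simp add: cdot_def inner_vec_def inner_complex_def)

lemma cnj_cdot: "cnj (cdot x y) = cdot y x"
  by (simp add: cdot_def mult.commute)

lemma cdot_scale_right: "cdot x (z *s y) = z * cdot x y"
  by (simp add: cdot_def sum_distrib_left mult_ac)

lemma hermitian_cnj_nth: "hermitian A \<Longrightarrow> cnj (A $ i $ j) = A $ j $ i"
  by (auto simp: hermitian_def ctranspose_def transpose_def vec_eq_iff)

lemma cdot_hermitian:
  assumes "hermitian A"
  shows "cdot (A *v x) y = cdot x (A *v y)"
proof -
  have "cdot (A *v x) y = (\<Sum>i\<in>UNIV. \<Sum>j\<in>UNIV. cnj (x $ j) * (A $ j $ i * y $ i))"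
    by (simp add: cdot_def matrix_vector_mult_def sum_distrib_right sum_distrib_left
        hermitian_cnj_nth[OF assms] mult_ac)
  also have "\<dots> = (\<Sum>j\<in>UNIV. \<Sum>i\<in>UNIV. cnj (x $ j) * (A $ j $ i * y $ i))"
    by (rule sum.swap)
  finally show ?thesis
    by (simp add: cdot_def matrix_vector_mult_def sum_distrib_left)
qed

lemma inner_hermitian: "hermitian A \<Longrightarrow> (A *v x) \<bullet> y = x \<bullet> (A *v y)"
  by (metis Re_cdot cdot_hermitian)

text \<open>Swapping arguments conjugates \<open>cdot\<close>, so the symmetry assumption makes
  \<open>cdot x y\<close> real; multiplied by the imaginary \<open>z\<close> it has real part
  zero.\<close>

lemma inner_imaginary_scale:
  assumes "Re z = 0" and "cdot x y = cdot y x"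
  shows "x \<bullet> (z *s y) = 0"
proof -
  have "Im (cdot x y) = 0"
    using cnj_cdot[of x y] assms(2) by (simp add: complex_eq_iff)
  then show ?thesis
    using assms(1) by (simp flip: Re_cdot add: cdot_scale_right)
qed

text \<open>Self-adjointness makes the complex energy its own conjugate, so conservation can be
  checked on the real inner product.\<close>

lemma energy_hermitian:
  assumes "hermitian A"
  shows "energy A x = of_real (x \<bullet> (A *v x))"
  using cnj_cdot[of x "A *v x"] cdot_hermitian[OF assms, of x x]
  by (simp add: energy_eq_cdot complex_eq_iff Re_cdot)

lemma hermitian_hermitian_procrustes: "hermitian (hermitian_procrustes X1 X2)"
  using hermitian_procrustes[of X1 X2]
  by (simp add: min_norm_procrustes_solution_def procrustes_solution_def)

lemma matrix_inv_right:
  assumes "invertible A"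
  shows "A ** matrix_inv A = mat 1"
  using someI_ex[OF assms[unfolded invertible_def]] by (simp add: matrix_inv_def)

lemma cscale_mult_vec: "(c *\<^sub>M A) *v x = c *s (A *v x)"
  by (simp add: vec_eq_iff cscale_def matrix_vector_mult_def sum_distrib_left mult_ac)

text \<open>Pairing a kernel vector \<open>v\<close> with itself kills the imaginary term and leaves
  \<open>v \<bullet> v = 0\<close>; a square matrix with trivial kernel is invertible.\<close>

lemma invertible_mat1_plus_imaginary_hermitian:
  assumes "hermitian A" and "Re c = 0"
  shows "invertible (mat 1 + c *\<^sub>M A)"
proof -
  have "v = 0" if "(mat 1 + c *\<^sub>M A) *v v = 0" for v
  proof -
    have "v + c *s (A *v v) = 0"
      using that by (simp add: matrix_vector_mult_add_rdistrib cscale_mult_vec)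
    moreover have "v \<bullet> (c *s (A *v v)) = 0"
      using assms cdot_hermitian[OF assms(1), of v v] by (simp add: inner_imaginary_scale)
    ultimately have "v \<bullet> v = 0"
      by (metis add.right_neutral inner_add_right inner_zero_right)
    then show ?thesis by simp
  qed
  then show ?thesis
    by (simp add: invertible_left_inverse matrix_left_invertible_ker)
qed

text \<open>Multiplying by \<open>mat 1 + c *\<^sub>M A\<close> clears the inverse and recovers the
  implicit midpoint form.\<close>

lemma cayley_step:
  assumes A: "hermitian A" and c: "Re c = 0"
    and w: "w = (matrix_inv (mat 1 + c *\<^sub>M A) ** (mat 1 - c *\<^sub>M A)) *v v"
  shows "w - v = (- c) *s (A *v (w + v))"
proof -
  have "(mat 1 + c *\<^sub>M A) ** matrix_inv (mat 1 + c *\<^sub>M A) = mat 1"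
    by (rule matrix_inv_right[OF invertible_mat1_plus_imaginary_hermitian[OF A c]])
  then have "(mat 1 + c *\<^sub>M A) *v w = (mat 1 - c *\<^sub>M A) *v v"
    by (simp add: w matrix_vector_mul_assoc matrix_mul_assoc)
  then have "w + c *s (A *v w) = v - c *s (A *v v)"
    by (simp add: matrix_vector_mult_add_rdistrib matrix_vector_mult_diff_rdistrib cscale_mult_vec)
  then show ?thesis
    by (simp add: matrix_vector_right_distrib vec_eq_iff algebra_simps)
qed

lemma cayley_conserves:
  assumes A: "hermitian A" and c: "Re c = 0"
    and w: "w = (matrix_inv (mat 1 + c *\<^sub>M A) ** (mat 1 - c *\<^sub>M A)) *v v"
  shows "norm w = norm v" and "energy A w = energy A v"
proof -
  define u where "u = w + v"
  have d: "w - v = (- c) *s (A *v u)"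
    unfolding u_def by (rule cayley_step[OF A c w])
  have "w \<bullet> w - v \<bullet> v = u \<bullet> (w - v)"
    by (simp add: u_def inner_simps inner_commute)
  also have "\<dots> = 0"
    unfolding d using c cdot_hermitian[OF A, of u u] by (intro inner_imaginary_scale) simp_all
  finally show "norm w = norm v"
    by (simp add: norm_eq_sqrt_inner)
  \<comment> \<open>The cross terms \<open>w \<bullet> (A *v v)\<close> and
    \<open>v \<bullet> (A *v w)\<close> cancel by self-adjointness.\<close>
  have "w \<bullet> (A *v w) - v \<bullet> (A *v v) = (A *v u) \<bullet> (w - v)"
    using inner_hermitian[OF A, of w v] inner_hermitian[OF A, of v w]
    by (simp add: u_def matrix_vector_right_distrib inner_simps inner_commute)
  also have "\<dots> = 0"
    unfolding d using c by (intro inner_imaginary_scale) simp_all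
  finally show "energy A w = energy A v"
    by (simp add: energy_hermitian[OF A])
qed

theorem theorem3p1:
  fixes \<tau> :: real
    and y :: "nat \<Rightarrow> complex ^ 'n"
    and A :: "complex ^ 'n ^ 'n"
    and x :: "nat \<Rightarrow> complex ^ 'n"
  assumes "\<tau> > 0"
    and "CARD('m::{finite,linorder}) \<le> CARD('n)"
    and "A = hermitian_procrustes (cn_X1 y :: complex ^ 'm::{finite,linorder} ^ 'n) (cn_X2 \<tau> y)"
    and "\<And>k. x (Suc k) =
           (matrix_inv (mat 1 + (\<i> * of_real \<tau> / 2) *\<^sub>M A) ** (mat 1 - (\<i> * of_real \<tau> / 2) *\<^sub>M A)) *v x k"
  shows "(\<forall>k. norm (x k) = norm (x 0)) \<and> (\<forall>k. energy A (x k) = energy A (x 0))"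
proof -
  have A: "hermitian A"
    unfolding assms(3) by (rule hermitian_hermitian_procrustes)
  have "norm (x k) = norm (x 0) \<and> energy A (x k) = energy A (x 0)" for k
    \<comment> \<open>The premise left as \<open>_\<close> says that
      \<open>\<i> * of_real \<tau> / 2\<close> has real part zero.\<close>
    by (induction k) (use cayley_conserves[OF A _ assms(4)] in simp_all)
  then show ?thesis by blast
qed

end
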